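(* Let $K$ be a set of formulas of $\mathcal{L}_{\mathcal{P}}$ and $\alpha$ a formula of $\mathcal{L}_{\mathcal{P}}$. Let $E=Cn(K'\cup EQ\cup\{\alpha\})\cap\mathcal{L}_{\mathcal{P}}$ be a consistent definitional extension of the belief change scenario $(Cn(K),\{\alpha\},\emptyset)$, where $EQ$ is the underlying set of equivalences. Then $$\bigl\{p\equiv p' \;\big|\; p\in(\mathit{Vocab}(K)\setminus\mathit{Vocab}(\alpha))\cup(\mathit{Vocab}(\alpha)\setminus\mathit{Vocab}(K))\bigr\}\subseteq EQ .$$
   Context: $\mathcal{L}_{\mathcal{P}}$ is the classical propositional language over a set $\mathcal{P}$ of atoms, $\vdash$ is classical consequence, and $Cn(\cdot)$ is deductive closure. $\mathcal{P}'=\{p'\mid p\in\mathcal{P}\}$ is a disjoint copy of $\mathcal{P}$. For a set of formulas $K$ of $\mathcal{L}_{\mathcal P}$, $K'$ is the result of replacing each atom $p$ by $p'$. $\mathit{Vocab}(\delta)$ is the set of atoms occurring in the formula or set of formulas $\delta$. A belief change scenario is a triple $(K,U,V)$ of sets of formulas of $\mathcal{L}_{\mathcal{P}}$. Let $EQ\subseteq\{p\equiv p'\mid p\in\mathcal{P}\}$ be maximal with respect to set inclusion such that $K'\cup EQ\cup U\cup V\not\vdash\bot$. Then $Cn(K'\cup EQ\cup U)\cap\mathcal{L}_{\mathcal{P}}$ is a consistent definitional extension of $(K,U,V)$, and $EQ$ is said to underlie it. *)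

theory Defs
  imports Main
begin

datatype (atoms: 'a) form =
    Atom 'a
  | Top
  | Bot
  | Neg "'a form"
  | And "'a form" "'a form"
  | Or "'a form" "'a form"
  | Imp "'a form" "'a form"
  | Iff "'a form" "'a form"

definition vocab :: "'a form set \<Rightarrow> 'a set" where
  "vocab \<Gamma> = (\<Union>\<phi>\<in>\<Gamma>. atoms \<phi>)"

definition lang :: "'a set \<Rightarrow> 'a form set" where
  "lang A = {\<phi>. atoms \<phi> \<subseteq> A}"

text \<open>Classical natural deduction. The context may be infinite; a derivation uses only
  finitely many of its members.\<close>

inductive derives :: "'a form set \<Rightarrow> 'a form \<Rightarrow> bool" (infix "\<turnstile>" 50) where
  Ass: "\<phi> \<in> \<Gamma> \<Longrightarrow> \<Gamma> \<turnstile> \<phi>"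
| TopI: "\<Gamma> \<turnstile> Top"
| NegI: "insert \<phi> \<Gamma> \<turnstile> Bot \<Longrightarrow> \<Gamma> \<turnstile> Neg \<phi>"
| NegE: "\<Gamma> \<turnstile> Neg \<phi> \<Longrightarrow> \<Gamma> \<turnstile> \<phi> \<Longrightarrow> \<Gamma> \<turnstile> Bot"
| RAA: "insert (Neg \<phi>) \<Gamma> \<turnstile> Bot \<Longrightarrow> \<Gamma> \<turnstile> \<phi>"
| AndI: "\<Gamma> \<turnstile> \<phi> \<Longrightarrow> \<Gamma> \<turnstile> \<psi> \<Longrightarrow> \<Gamma> \<turnstile> And \<phi> \<psi>"
| AndE1: "\<Gamma> \<turnstile> And \<phi> \<psi> \<Longrightarrow> \<Gamma> \<turnstile> \<phi>"
| AndE2: "\<Gamma> \<turnstile> And \<phi> \<psi> \<Longrightarrow> \<Gamma> \<turnstile> \<psi>"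
| OrI1: "\<Gamma> \<turnstile> \<phi> \<Longrightarrow> \<Gamma> \<turnstile> Or \<phi> \<psi>"
| OrI2: "\<Gamma> \<turnstile> \<psi> \<Longrightarrow> \<Gamma> \<turnstile> Or \<phi> \<psi>"
| OrE: "\<Gamma> \<turnstile> Or \<phi> \<psi> \<Longrightarrow> insert \<phi> \<Gamma> \<turnstile> \<chi> \<Longrightarrow> insert \<psi> \<Gamma> \<turnstile> \<chi> \<Longrightarrow> \<Gamma> \<turnstile> \<chi>"
| ImpI: "insert \<phi> \<Gamma> \<turnstile> \<psi> \<Longrightarrow> \<Gamma> \<turnstile> Imp \<phi> \<psi>"
| ImpE: "\<Gamma> \<turnstile> Imp \<phi> \<psi> \<Longrightarrow> \<Gamma> \<turnstile> \<phi> \<Longrightarrow> \<Gamma> \<turnstile> \<psi>"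
| IffI: "insert \<phi> \<Gamma> \<turnstile> \<psi> \<Longrightarrow> insert \<psi> \<Gamma> \<turnstile> \<phi> \<Longrightarrow> \<Gamma> \<turnstile> Iff \<phi> \<psi>"
| IffE1: "\<Gamma> \<turnstile> Iff \<phi> \<psi> \<Longrightarrow> \<Gamma> \<turnstile> \<phi> \<Longrightarrow> \<Gamma> \<turnstile> \<psi>"
| IffE2: "\<Gamma> \<turnstile> Iff \<phi> \<psi> \<Longrightarrow> \<Gamma> \<turnstile> \<psi> \<Longrightarrow> \<Gamma> \<turnstile> \<phi>"

text \<open>The calculus is sound and complete for two-valued semantics
  (\<open>derives_iff_models\<close> below), so it is classical consequence. The statement
  itself does not use the semantics.\<close>

primrec holds :: "('a \<Rightarrow> bool) \<Rightarrow> 'a form \<Rightarrow> bool" where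
  "holds v (Atom a) = v a"
| "holds v Top = True"
| "holds v Bot = False"
| "holds v (Neg \<phi>) = (\<not> holds v \<phi>)"
| "holds v (And \<phi> \<psi>) = (holds v \<phi> \<and> holds v \<psi>)"
| "holds v (Or \<phi> \<psi>) = (holds v \<phi> \<or> holds v \<psi>)"
| "holds v (Imp \<phi> \<psi>) = (holds v \<phi> \<longrightarrow> holds v \<psi>)"
| "holds v (Iff \<phi> \<psi>) = (holds v \<phi> \<longleftrightarrow> holds v \<psi>)"

lemma derives_sound: "\<Gamma> \<turnstile> \<phi> \<Longrightarrow> \<forall>\<gamma>\<in>\<Gamma>. holds v \<gamma> \<Longrightarrow> holds v \<phi>"
  by (induction rule: derives.induct) auto

lemma derives_mono: "\<Gamma> \<turnstile> \<phi> \<Longrightarrow> \<Gamma> \<subseteq> \<Delta> \<Longrightarrow> \<Delta> \<turnstile> \<phi>"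
proof (induction arbitrary: \<Delta> rule: derives.induct)
  case Ass
  then show ?case by (blast intro: derives.Ass)
next
  case TopI
  show ?case by (rule derives.TopI)
next
  case NegI
  then show ?case by (meson derives.NegI insert_mono)
next
  case NegE
  then show ?case by (meson derives.NegE insert_mono)
next
  case RAA
  then show ?case by (meson derives.RAA insert_mono)
next
  case AndI
  then show ?case by (meson derives.AndI insert_mono)
next
  case AndE1
  then show ?case by (meson derives.AndE1 insert_mono)
next
  case AndE2
  then show ?case by (meson derives.AndE2 insert_mono)
next
  case OrI1
  then show ?case by (meson derives.OrI1 insert_mono)
next
  case OrI2
  then show ?case by (meson derives.OrI2 insert_mono)
next
  case OrE
  then show ?case by (meson derives.OrE insert_mono)
next
  case ImpI
  then show ?case by (meson derives.ImpI insert_mono)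
next
  case ImpE
  then show ?case by (meson derives.ImpE insert_mono)
next
  case IffI
  then show ?case by (meson derives.IffI insert_mono)
next
  case IffE1
  then show ?case by (meson derives.IffE1 insert_mono)
next
  case IffE2
  then show ?case by (meson derives.IffE2 insert_mono)
qed

lemma derives_finite: "\<Gamma> \<turnstile> \<phi> \<Longrightarrow> \<exists>\<Delta>. finite \<Delta> \<and> \<Delta> \<subseteq> \<Gamma> \<and> \<Delta> \<turnstile> \<phi>"
proof (induction rule: derives.induct)
  case (Ass \<phi> \<Gamma>)
  then show ?case by (intro exI[of _ "{\<phi>}"]) (auto intro: derives.Ass)
next
  case (TopI \<Gamma>)
  then show ?case by (intro exI[of _ "{}"]) (auto intro: derives.TopI)
next
  case (NegI \<phi> \<Gamma>)
  then obtain \<Delta> where "finite \<Delta>" "\<Delta> \<subseteq> insert \<phi> \<Gamma>" "\<Delta> \<turnstile> Bot" by blast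
  then show ?case
    by (intro exI[of _ "\<Delta> - {\<phi>}"]) (auto intro!: derives.NegI intro: derives_mono)
next
  case (RAA \<phi> \<Gamma>)
  then obtain \<Delta> where "finite \<Delta>" "\<Delta> \<subseteq> insert (Neg \<phi>) \<Gamma>" "\<Delta> \<turnstile> Bot" by blast
  then show ?case
    by (intro exI[of _ "\<Delta> - {Neg \<phi>}"]) (auto intro!: derives.RAA[of \<phi>] intro: derives_mono)
next
  case (ImpI \<phi> \<Gamma> \<psi>)
  then obtain \<Delta> where "finite \<Delta>" "\<Delta> \<subseteq> insert \<phi> \<Gamma>" "\<Delta> \<turnstile> \<psi>" by blast
  then show ?case
    by (intro exI[of _ "\<Delta> - {\<phi>}"]) (auto intro!: derives.ImpI intro: derives_mono)
next
  case (OrE \<Gamma> \<phi> \<psi> \<chi>)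
  then obtain A B C where A: "finite A" "A \<subseteq> \<Gamma>" "A \<turnstile> Or \<phi> \<psi>"
    and B: "finite B" "B \<subseteq> insert \<phi> \<Gamma>" "B \<turnstile> \<chi>"
    and C: "finite C" "C \<subseteq> insert \<psi> \<Gamma>" "C \<turnstile> \<chi>" by meson
  let ?D = "A \<union> (B - {\<phi>}) \<union> (C - {\<psi>})"
  have "?D \<turnstile> Or \<phi> \<psi>" by (rule derives_mono[OF A(3)]) blast
  moreover have "insert \<phi> ?D \<turnstile> \<chi>" by (rule derives_mono[OF B(3)]) blast
  moreover have "insert \<psi> ?D \<turnstile> \<chi>" by (rule derives_mono[OF C(3)]) blast
  ultimately have "?D \<turnstile> \<chi>" by (rule derives.OrE)
  moreover have "finite ?D" using A(1) B(1) C(1) by simp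
  moreover have "?D \<subseteq> \<Gamma>" using A(2) B(2) C(2) by (simp add: Diff_subset_conv)
  ultimately show ?case by (intro exI conjI)
next
  case (IffI \<phi> \<Gamma> \<psi>)
  then obtain B C where B: "finite B" "B \<subseteq> insert \<phi> \<Gamma>" "B \<turnstile> \<psi>"
    and C: "finite C" "C \<subseteq> insert \<psi> \<Gamma>" "C \<turnstile> \<phi>" by meson
  let ?D = "(B - {\<phi>}) \<union> (C - {\<psi>})"
  have "insert \<phi> ?D \<turnstile> \<psi>" by (rule derives_mono[OF B(3)]) blast
  moreover have "insert \<psi> ?D \<turnstile> \<phi>" by (rule derives_mono[OF C(3)]) blast
  ultimately have "?D \<turnstile> Iff \<phi> \<psi>" by (rule derives.IffI)
  moreover have "finite ?D" using B(1) C(1) by simp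
  moreover have "?D \<subseteq> \<Gamma>" using B(2) C(2) by (simp add: Diff_subset_conv)
  ultimately show ?case by (intro exI conjI)
next
  case (NegE \<Gamma> \<phi>)
  then obtain A B where A: "finite A" "A \<subseteq> \<Gamma>" "A \<turnstile> Neg \<phi>" and B: "finite B" "B \<subseteq> \<Gamma>" "B \<turnstile> \<phi>" by meson
  have "A \<union> B \<turnstile> Bot"
    by (rule derives.NegE[OF derives_mono[OF A(3)] derives_mono[OF B(3)]]) auto
  moreover have "finite (A \<union> B)" using A(1) B(1) by simp
  moreover have "A \<union> B \<subseteq> \<Gamma>" using A(2) B(2) by simp
  ultimately show ?case by (intro exI conjI)
next
  case (AndI \<Gamma> \<phi> \<psi>)
  then obtain A B where A: "finite A" "A \<subseteq> \<Gamma>" "A \<turnstile> \<phi>" and B: "finite B" "B \<subseteq> \<Gamma>" "B \<turnstile> \<psi>" by meson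
  have "A \<union> B \<turnstile> And \<phi> \<psi>"
    by (rule derives.AndI[OF derives_mono[OF A(3)] derives_mono[OF B(3)]]) auto
  moreover have "finite (A \<union> B)" using A(1) B(1) by simp
  moreover have "A \<union> B \<subseteq> \<Gamma>" using A(2) B(2) by simp
  ultimately show ?case by (intro exI conjI)
next
  case (ImpE \<Gamma> \<phi> \<psi>)
  then obtain A B where A: "finite A" "A \<subseteq> \<Gamma>" "A \<turnstile> Imp \<phi> \<psi>" and B: "finite B" "B \<subseteq> \<Gamma>" "B \<turnstile> \<phi>" by meson
  have "A \<union> B \<turnstile> \<psi>"
    by (rule derives.ImpE[OF derives_mono[OF A(3)] derives_mono[OF B(3)]]) auto
  moreover have "finite (A \<union> B)" using A(1) B(1) by simp
  moreover have "A \<union> B \<subseteq> \<Gamma>" using A(2) B(2) by simp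
  ultimately show ?case by (intro exI conjI)
next
  case (IffE1 \<Gamma> \<phi> \<psi>)
  then obtain A B where A: "finite A" "A \<subseteq> \<Gamma>" "A \<turnstile> Iff \<phi> \<psi>" and B: "finite B" "B \<subseteq> \<Gamma>" "B \<turnstile> \<phi>" by meson
  have "A \<union> B \<turnstile> \<psi>"
    by (rule derives.IffE1[OF derives_mono[OF A(3)] derives_mono[OF B(3)]]) auto
  moreover have "finite (A \<union> B)" using A(1) B(1) by simp
  moreover have "A \<union> B \<subseteq> \<Gamma>" using A(2) B(2) by simp
  ultimately show ?case by (intro exI conjI)
next
  case (IffE2 \<Gamma> \<phi> \<psi>)
  then obtain A B where A: "finite A" "A \<subseteq> \<Gamma>" "A \<turnstile> Iff \<phi> \<psi>" and B: "finite B" "B \<subseteq> \<Gamma>" "B \<turnstile> \<psi>" by meson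
  have "A \<union> B \<turnstile> \<phi>"
    by (rule derives.IffE2[OF derives_mono[OF A(3)] derives_mono[OF B(3)]]) auto
  moreover have "finite (A \<union> B)" using A(1) B(1) by simp
  moreover have "A \<union> B \<subseteq> \<Gamma>" using A(2) B(2) by simp
  ultimately show ?case by (intro exI conjI)
next
  case (AndE1 \<Gamma> \<phi> \<psi>)
  then show ?case by (meson derives.AndE1)
next
  case (AndE2 \<Gamma> \<phi> \<psi>)
  then show ?case by (meson derives.AndE2)
next
  case (OrI1 \<Gamma> \<phi> \<psi>)
  then show ?case by (meson derives.OrI1)
next
  case (OrI2 \<Gamma> \<psi> \<phi>)
  then show ?case by (meson derives.OrI2)
qed

lemma consistent_extends_to_maximal:
  assumes "\<not> \<Gamma> \<turnstile> Bot"
  obtains M where "\<Gamma> \<subseteq> M" "\<not> M \<turnstile> Bot" "\<And>\<phi>. \<phi> \<notin> M \<Longrightarrow> insert \<phi> M \<turnstile> Bot"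
proof -
  let ?S = "{M. \<Gamma> \<subseteq> M \<and> \<not> M \<turnstile> Bot}"
  have "\<exists>M\<in>?S. \<forall>X\<in>?S. M \<subseteq> X \<longrightarrow> X = M"
  proof (rule subset_Zorn_nonempty)
    show "?S \<noteq> {}" using assms by blast
    fix C assume C: "C \<noteq> {}" "subset.chain ?S C"
    have "\<not> \<Union>C \<turnstile> Bot"
    proof
      assume "\<Union>C \<turnstile> Bot"
      then obtain \<Delta> where \<Delta>: "finite \<Delta>" "\<Delta> \<subseteq> \<Union>C" "\<Delta> \<turnstile> Bot"
        using derives_finite by blast
      then obtain X where "X \<in> C" "\<Delta> \<subseteq> X"
        using finite_subset_Union_chain[OF \<Delta>(1,2) C] by blast
      with \<Delta>(3) C(2) show False
        by (auto simp: subset_chain_def dest: derives_mono)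
    qed
    moreover obtain X where X: "X \<in> C" using C(1) by blast
    then have "\<Gamma> \<subseteq> X" using C(2) by (auto simp: subset_chain_def)
    with X have "\<Gamma> \<subseteq> \<Union>C" by blast
    ultimately show "\<Union>C \<in> ?S" by blast
  qed
  then obtain M where M: "\<Gamma> \<subseteq> M" "\<not> M \<turnstile> Bot" "\<forall>X\<in>?S. M \<subseteq> X \<longrightarrow> X = M" by auto
  have "insert \<phi> M \<turnstile> Bot" if "\<phi> \<notin> M" for \<phi>
  proof (rule ccontr)
    assume "\<not> insert \<phi> M \<turnstile> Bot"
    then have "insert \<phi> M = M" using M(1) by (intro M(3)[rule_format]) auto
    with that show False by blast
  qed
  with M(1,2) show thesis using that by blast
qed

lemma consistent_satisfiable:
  assumes "\<not> \<Gamma> \<turnstile> Bot"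
  shows "\<exists>v. \<forall>\<gamma>\<in>\<Gamma>. holds v \<gamma>"
proof -
  obtain M where M: "\<Gamma> \<subseteq> M" "\<not> M \<turnstile> Bot" "\<And>\<phi>. \<phi> \<notin> M \<Longrightarrow> insert \<phi> M \<turnstile> Bot"
    using consistent_extends_to_maximal[OF assms] by blast
  have closed: "\<phi> \<in> M" if "M \<turnstile> \<phi>" for \<phi>
  proof (rule ccontr)
    assume "\<phi> \<notin> M"
    then have "M \<turnstile> Neg \<phi>" by (intro derives.NegI M(3))
    then show False using that M(2) derives.NegE by blast
  qed
  have neg: "Neg \<phi> \<in> M \<longleftrightarrow> \<phi> \<notin> M" for \<phi>
  proof
    assume "Neg \<phi> \<in> M"
    then show "\<phi> \<notin> M" using M(2) derives.NegE[OF derives.Ass derives.Ass] by blast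
  next
    assume "\<phi> \<notin> M"
    then show "Neg \<phi> \<in> M" by (intro closed derives.NegI M(3))
  qed
  have imp: "insert \<phi> M \<turnstile> \<psi>" if "\<phi> \<in> M \<longrightarrow> \<psi> \<in> M" for \<phi> \<psi>
  proof (cases "\<phi> \<in> M")
    case True
    with that show ?thesis by (intro derives.Ass) simp
  next
    case False
    show ?thesis
      by (rule derives.RAA, rule derives_mono[OF M(3)[OF False]]) blast
  qed
  have "holds (\<lambda>a. Atom a \<in> M) \<phi> \<longleftrightarrow> \<phi> \<in> M" for \<phi>
  proof (induction \<phi>)
    case Top
    show ?case using closed[OF derives.TopI] by simp
  next
    case Bot
    show ?case using M(2) derives.Ass[of Bot M] by auto
  next
    case (Neg \<phi>)
    then show ?case by (simp add: neg)
  next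
    case (And \<phi> \<psi>)
    have "And \<phi> \<psi> \<in> M \<longleftrightarrow> \<phi> \<in> M \<and> \<psi> \<in> M"
      using closed derives.Ass derives.AndI derives.AndE1 derives.AndE2 by metis
    with And show ?case by simp
  next
    case (Or \<phi> \<psi>)
    have "\<phi> \<in> M \<or> \<psi> \<in> M" if "Or \<phi> \<psi> \<in> M"
    proof (rule ccontr)
      assume "\<not> (\<phi> \<in> M \<or> \<psi> \<in> M)"
      then have "M \<turnstile> Bot" using derives.OrE[OF derives.Ass[OF that] M(3) M(3)] by blast
      with M(2) show False ..
    qed
    then have "Or \<phi> \<psi> \<in> M \<longleftrightarrow> \<phi> \<in> M \<or> \<psi> \<in> M"
      using closed derives.Ass derives.OrI1 derives.OrI2 by metis
    with Or show ?case by simp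
  next
    case (Imp \<phi> \<psi>)
    have "Imp \<phi> \<psi> \<in> M \<longleftrightarrow> (\<phi> \<in> M \<longrightarrow> \<psi> \<in> M)"
      using closed imp derives.Ass derives.ImpI derives.ImpE by metis
    with Imp show ?case by simp
  next
    case (Iff \<phi> \<psi>)
    have "Iff \<phi> \<psi> \<in> M \<longleftrightarrow> (\<phi> \<in> M \<longleftrightarrow> \<psi> \<in> M)"
      using closed imp derives.Ass derives.IffI derives.IffE1 derives.IffE2 by metis
    with Iff show ?case by simp
  qed simp
  with M(1) show ?thesis by blast
qed

theorem derives_iff_models: "\<Gamma> \<turnstile> \<phi> \<longleftrightarrow> (\<forall>v. (\<forall>\<gamma>\<in>\<Gamma>. holds v \<gamma>) \<longrightarrow> holds v \<phi>)"
proof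
  assume "\<forall>v. (\<forall>\<gamma>\<in>\<Gamma>. holds v \<gamma>) \<longrightarrow> holds v \<phi>"
  then have "insert (Neg \<phi>) \<Gamma> \<turnstile> Bot"
    using consistent_satisfiable[of "insert (Neg \<phi>) \<Gamma>"] by auto
  then show "\<Gamma> \<turnstile> \<phi>" by (rule derives.RAA)
qed (blast dest: derives_sound)

text \<open>Deductive closure is relative to the language over the atoms \<open>A\<close>.\<close>

definition Cn :: "'a set \<Rightarrow> 'a form set \<Rightarrow> 'a form set" where
  "Cn A \<Gamma> = {\<phi> \<in> lang A. \<Gamma> \<turnstile> \<phi>}"

text \<open>For a set \<open>P\<close> of atom names, \<open>Orig ` P\<close> is the set of atoms of the object language and
  \<open>Primed ` P\<close> is its disjoint copy.\<close>

datatype 'p atom = Orig 'p | Primed 'p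

abbreviation LP :: "'p set \<Rightarrow> 'p atom form set" where
  "LP P \<equiv> lang (Orig ` P)"

abbreviation CnP :: "'p set \<Rightarrow> 'p atom form set \<Rightarrow> 'p atom form set" where
  "CnP P \<equiv> Cn (Orig ` P)"

abbreviation CnPP :: "'p set \<Rightarrow> 'p atom form set \<Rightarrow> 'p atom form set" where
  "CnPP P \<equiv> Cn (Orig ` P \<union> Primed ` P)"

text \<open>Only the first equation matters: priming is applied to formulas of \<open>LP P\<close> only.\<close>

primrec prime :: "'p atom \<Rightarrow> 'p atom" where
  "prime (Orig p) = Primed p"
| "prime (Primed p) = Primed p"

definition primed :: "'p atom form set \<Rightarrow> 'p atom form set" where
  "primed K = map_form prime ` K"

definition eqv :: "'p atom \<Rightarrow> 'p atom form" where
  "eqv a = Iff (Atom a) (Atom (prime a))"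

definition scenario ::
    "'p set \<Rightarrow> 'p atom form set \<times> 'p atom form set \<times> 'p atom form set \<Rightarrow> bool" where
  "scenario P = (\<lambda>(K, U, V). K \<subseteq> LP P \<and> U \<subseteq> LP P \<and> V \<subseteq> LP P)"

definition admissible :: "'p set \<Rightarrow>
    'p atom form set \<times> 'p atom form set \<times> 'p atom form set \<Rightarrow> 'p atom form set \<Rightarrow> bool" where
  "admissible P = (\<lambda>(K, U, V) EQ.
     EQ \<subseteq> {eqv a | a. a \<in> Orig ` P} \<and> \<not> primed K \<union> EQ \<union> U \<union> V \<turnstile> Bot)"

text \<open>\<open>E\<close> is a consistent definitional extension of the scenario \<open>S\<close>, and \<open>EQ\<close> underlies it.\<close>

definition consistent_def_extension :: "'p set \<Rightarrow>
    'p atom form set \<times> 'p atom form set \<times> 'p atom form set \<Rightarrow>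
    'p atom form set \<Rightarrow> 'p atom form set \<Rightarrow> bool" where
  "consistent_def_extension P S EQ E \<longleftrightarrow>
     scenario P S \<and>
     admissible P S EQ \<and> (\<forall>EQ'. admissible P S EQ' \<and> EQ \<subseteq> EQ' \<longrightarrow> EQ' = EQ) \<and>
     (case S of (K, U, V) \<Rightarrow> E = CnPP P (primed K \<union> EQ \<union> U) \<inter> LP P)"

end

theory Submission
  imports Defs
begin

text \<open>If an atom occurs in only one of \<open>K\<close> and \<open>\<alpha>\<close>, then in any model of
  \<open>K' \<union> EQ \<union> {\<alpha>}\<close> one of its two copies is constrained by \<open>EQ\<close> alone. Giving this copy
  the value of the other one keeps the theory satisfied and makes the equivalence of the two true,
  so by maximality the equivalence already belongs to \<open>EQ\<close>.\<close>

lemma holds_map_form: "holds v (map_form f \<phi>) \<longleftrightarrow> holds (v \<circ> f) \<phi>"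
  by (induction \<phi>) auto

lemma holds_cong:
  assumes "\<And>a. a \<in> atoms \<phi> \<Longrightarrow> v a = w a"
  shows "holds v \<phi> \<longleftrightarrow> holds w \<phi>"
  using assms by (induction \<phi>) auto

lemma derives_Bot_iff: "\<Gamma> \<turnstile> Bot \<longleftrightarrow> \<not> (\<exists>v. \<forall>\<gamma>\<in>\<Gamma>. holds v \<gamma>)"
  by (simp add: derives_iff_models)

lemma holds_eqv: "holds v (eqv a) \<longleftrightarrow> v a = v (prime a)"
  by (simp add: eqv_def)

text \<open>Soundness at the valuation \<open>v \<circ> prime\<close> covers the whole closure. The
  closure may mention atoms outside \<open>vocab K\<close>, so a modified valuation is tested on
  \<open>K\<close> alone and this lemma transfers the result.\<close>

lemma holds_primed_Cn:
  assumes "\<forall>\<phi>\<in>K. holds (v \<circ> prime) \<phi>" and "\<gamma> \<in> primed (Cn A K)"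
  shows "holds v \<gamma>"
  using assms by (auto simp: primed_def Cn_def holds_map_form dest: derives_sound)

lemma consistent_def_extension_model:
  assumes "consistent_def_extension P (K, U, V) EQ E"
  obtains v where "\<forall>\<gamma>\<in>primed K \<union> EQ \<union> U \<union> V. holds v \<gamma>"
  using assms by (auto simp: consistent_def_extension_def admissible_def derives_Bot_iff)

text \<open>The model \<open>v\<close> makes the enlarged set of equivalences admissible, and
  maximality of \<open>EQ\<close> rules out a proper enlargement.\<close>

lemma consistent_def_extension_eqv_in:
  assumes ext: "consistent_def_extension P (K, U, V) EQ E"
    and "p \<in> P" and "\<forall>\<gamma>\<in>primed K \<union> insert (eqv (Orig p)) EQ \<union> U \<union> V. holds v \<gamma>"
  shows "eqv (Orig p) \<in> EQ"
proof -
  have "\<not> primed K \<union> insert (eqv (Orig p)) EQ \<union> U \<union> V \<turnstile> Bot"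
    using assms(3) unfolding derives_Bot_iff by blast
  moreover have "insert (eqv (Orig p)) EQ \<subseteq> {eqv a | a. a \<in> Orig ` P}"
    using ext \<open>p \<in> P\<close> by (auto simp: consistent_def_extension_def admissible_def)
  ultimately have "admissible P (K, U, V) (insert (eqv (Orig p)) EQ)"
    by (simp add: admissible_def)
  then have "insert (eqv (Orig p)) EQ = EQ"
    using ext unfolding consistent_def_extension_def by blast
  then show ?thesis by blast
qed

text \<open>For \<open>q \<noteq> p\<close> neither side of the equivalence is touched; for
  \<open>q = p\<close> the update makes both sides equal.\<close>

lemma holds_eqv_fun_upd:
  assumes "holds v (eqv (Orig q))"
  shows "holds (v(Orig p := v (Primed p))) (eqv (Orig q))"
    and "holds (v(Primed p := v (Orig p))) (eqv (Orig q))"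
  using assms by (auto simp: holds_eqv)

theorem theorem11:
  fixes P :: "'p set" and K EQ E :: "'p atom form set" and \<alpha> :: "'p atom form"
  assumes "K \<subseteq> LP P" and "\<alpha> \<in> LP P"
    and "E = CnPP P (primed K \<union> EQ \<union> {\<alpha>}) \<inter> LP P"
    and "consistent_def_extension P (CnP P K, {\<alpha>}, {}) EQ E"
  shows "{eqv a | a. a \<in> (vocab K - atoms \<alpha>) \<union> (atoms \<alpha> - vocab K)} \<subseteq> EQ"
proof clarify
  fix a assume a: "a \<in> (vocab K - atoms \<alpha>) \<union> (atoms \<alpha> - vocab K)"
  have voc: "vocab K \<subseteq> Orig ` P" "atoms \<alpha> \<subseteq> Orig ` P"
    using assms(1,2) by (auto simp: vocab_def lang_def)
  then obtain p where p: "p \<in> P" "a = Orig p" using a by blast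
  obtain v where v: "\<forall>\<gamma>\<in>primed (CnP P K) \<union> EQ \<union> {\<alpha>} \<union> {}. holds v \<gamma>"
    by (rule consistent_def_extension_model[OF assms(4)])
  have "K \<subseteq> CnP P K" using assms(1) by (auto simp: Cn_def intro: derives.Ass)
  then have vK: "\<forall>\<phi>\<in>K. holds (v \<circ> prime) \<phi>"
    using v by (simp add: primed_def ball_Un holds_map_form subset_iff)
  have EQ: "EQ \<subseteq> {eqv (Orig q) | q. q \<in> P}"
    using assms(4) by (auto simp: consistent_def_extension_def admissible_def)
  obtain w where wK: "\<forall>\<phi>\<in>K. holds (w \<circ> prime) \<phi>"
    and w: "holds w (eqv (Orig p))" "\<forall>\<gamma>\<in>EQ. holds w \<gamma>" "holds w \<alpha>"
  proof (cases "a \<in> vocab K")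
    case True
    \<comment> \<open>Here \<open>a\<close> does not occur in \<alpha>, so the unprimed copy is the
      free one: formulas of \<open>K\<close> are read through \<open>prime\<close>, which never
      yields \<open>Orig p\<close>.\<close>
    let ?w = "v(Orig p := v (Primed p))"
    have "prime b \<noteq> Orig p" for b by (cases b) auto
    then have "?w \<circ> prime = v \<circ> prime" by auto
    then have "\<forall>\<phi>\<in>K. holds (?w \<circ> prime) \<phi>" using vK by simp
    moreover have "holds ?w \<alpha> \<longleftrightarrow> holds v \<alpha>"
      using True a p by (intro holds_cong) auto
    moreover have "\<forall>\<gamma>\<in>EQ. holds ?w \<gamma>"
      using v EQ by (auto dest!: subsetD intro!: holds_eqv_fun_upd)
    ultimately show thesis using v by (intro that[of ?w]) (auto simp: holds_eqv)
  next
    case False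
    \<comment> \<open>Now the primed copy is free: only an occurrence of \<open>a\<close> in
      \<open>K\<close> could produce it, and \<alpha> has unprimed atoms only.\<close>
    let ?w = "v(Primed p := v (Orig p))"
    have "holds (?w \<circ> prime) \<phi> \<longleftrightarrow> holds (v \<circ> prime) \<phi>" if "\<phi> \<in> K" for \<phi>
    proof (rule holds_cong)
      fix b assume "b \<in> atoms \<phi>"
      then have "b \<in> vocab K" using that by (auto simp: vocab_def)
      then obtain q where "b = Orig q" "q \<noteq> p" using voc False p by blast
      then show "(?w \<circ> prime) b = (v \<circ> prime) b" by simp
    qed
    then have "\<forall>\<phi>\<in>K. holds (?w \<circ> prime) \<phi>" using vK by simp
    moreover have "holds ?w \<alpha> \<longleftrightarrow> holds v \<alpha>"
      using voc by (intro holds_cong) auto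
    moreover have "\<forall>\<gamma>\<in>EQ. holds ?w \<gamma>"
      using v EQ by (auto dest!: subsetD intro!: holds_eqv_fun_upd)
    ultimately show thesis using v by (intro that[of ?w]) (auto simp: holds_eqv)
  qed
  \<comment> \<open>The scenario is built on the closure of \<open>K\<close>, so truth at
    \<open>w\<close> must pass from \<open>K\<close> to \<open>CnP P K\<close> before maximality
    applies.\<close>
  then have "\<forall>\<gamma>\<in>primed (CnP P K) \<union> insert (eqv (Orig p)) EQ \<union> {\<alpha>} \<union> {}. holds w \<gamma>"
    using holds_primed_Cn[OF wK] by blast
  then show "eqv a \<in> EQ"
    using consistent_def_extension_eqv_in[OF assms(4) p(1)] p(2) by blast
qed

end
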